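(* Let $\rho>1$ and let $\Lambda_{\mathrm{hex}}=L_{\mathrm{hex}}\mathbb{Z}^2$ be the hexagonal lattice with generator matrix $$L_{\mathrm{hex}}=\begin{bmatrix}\frac{\sqrt2}{\sqrt[4]{3}\sqrt{\rho}} & \frac{1}{\sqrt[4]{3}\sqrt{2\rho}}\\ 0 & \frac{\sqrt[4]{3}}{\sqrt{2\rho}}\end{bmatrix}.$$ Let $\phi=\phi_1$ be the Gaussian $\phi(x)=2^{1/4}e^{-\pi x^2}$. Then the Gabor frame $\mathcal{G}(\phi,\Lambda_{\mathrm{hex}})$ for $L^2(\mathbb{R})$, which has redundancy $\rho$, is a Grassmannian frame among all Gabor frames of redundancy $\rho$ with Gaussian window; that is, for every $\sigma>0$ and every lattice $\Lambda\subset\mathbb{R}^2$ with $\mathrm{vol}(\Lambda)=1/\rho$, $$\max_{\lambda,\lambda'\in\Lambda_{\mathrm{hex}},\,\lambda\ne\lambda'}|\langle\phi_{\lambda},\phi_{\lambda'}\rangle|\;\le\;\max_{\lambda,\lambda'\in\Lambda,\,\lambda\ne\lambda'}|\langle(\phi_\sigma)_{\lambda},(\phi_\sigma)_{\lambda'}\rangle|,$$ where $\phi_\lambda$ denotes the time-frequency shift of $\phi$ by $\lambda$.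
   Context: For $\sigma>0$ the Gaussian window is $\phi_\sigma(x)=(2/\sigma)^{1/4}e^{-\pi x^2/\sigma}$, which has unit norm in $L^2(\mathbb{R})$. For $g\in L^2(\mathbb{R})$ and $\lambda=(x,\omega)\in\mathbb{R}^2$, the time-frequency shift is $g_\lambda(t)=e^{2\pi i\omega t}g(t-x)$. A lattice $\Lambda\subset\mathbb{R}^2$ is a set $L\mathbb{Z}^2$ with $L\in GL(2,\mathbb{R})$, and $\mathrm{vol}(\Lambda)=|\det L|$. The Gabor system is $\mathcal{G}(g,\Lambda)=\{g_\lambda:\lambda\in\Lambda\}$; it is a Gabor frame if it is a frame for $L^2(\mathbb{R})$, i.e. there are $A,B>0$ with $A\|f\|^2\le\sum_{\lambda\in\Lambda}|\langle f,g_\lambda\rangle|^2\le B\|f\|^2$ for all $f\in L^2(\mathbb{R})$. The redundancy of a Gabor frame $\mathcal{G}(g,\Lambda)$ is $1/\mathrm{vol}(\Lambda)$. It is known that $\mathcal{G}(\phi_\sigma,\Lambda)$ is a Gabor frame for every $\sigma>0$ whenever $\mathrm{vol}(\Lambda)<1$. In the notation $\phi_\lambda$ the subscript is a point of the lattice, whereas in $\phi_\sigma$ it is the width parameter. *)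

theory Defs
  imports "HOL-Analysis.Analysis"
begin

text \<open>\<open>L\<^sup>2(\<real>)\<close> is represented by square-integrable Borel functions instead of classes modulo
  null sets; the quantities below depend only on the class.\<close>

definition L2 :: "(real \<Rightarrow> complex) set" where
  "L2 = {f. f \<in> borel_measurable lborel \<and> integrable lborel (\<lambda>t. (cmod (f t))\<^sup>2)}"

definition L2_inner :: "(real \<Rightarrow> complex) \<Rightarrow> (real \<Rightarrow> complex) \<Rightarrow> complex" where
  "L2_inner f g = (\<integral>t. f t * cnj (g t) \<partial>lborel)"

definition L2_norm :: "(real \<Rightarrow> complex) \<Rightarrow> real" where
  "L2_norm f = sqrt (\<integral>t. (cmod (f t))\<^sup>2 \<partial>lborel)"

definition gauss :: "real \<Rightarrow> real \<Rightarrow> complex" where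
  "gauss \<sigma> x = complex_of_real ((2 / \<sigma>) powr (1 / 4) * exp (- pi * x\<^sup>2 / \<sigma>))"

text \<open>A point \<open>(x, \<omega>)\<close> of the time-frequency plane has \<open>x\<close> as component 1 and \<open>\<omega>\<close> as
  component 2.\<close>

definition tf_shift :: "real^2 \<Rightarrow> (real \<Rightarrow> complex) \<Rightarrow> real \<Rightarrow> complex" where
  "tf_shift p g t = cis (2 * pi * (p $ 2) * t) * g (t - p $ 1)"

definition lattice_of :: "real^2^2 \<Rightarrow> (real^2) set" where
  "lattice_of L = range (\<lambda>k :: int^2. L *v (\<chi> i. real_of_int (k $ i)))"

definition is_lattice :: "(real^2) set \<Rightarrow> bool" where
  "is_lattice \<Lambda> \<longleftrightarrow> (\<exists>L. invertible L \<and> \<Lambda> = lattice_of L)"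

text \<open>Independence of the generator matrix is shown in \<open>vol_lattice_of\<close>.\<close>

definition vol :: "(real^2) set \<Rightarrow> real" where
  "vol \<Lambda> = (THE v. \<exists>L. invertible L \<and> \<Lambda> = lattice_of L \<and> v = \<bar>det L\<bar>)"

definition is_gabor_frame :: "(real \<Rightarrow> complex) \<Rightarrow> (real^2) set \<Rightarrow> bool" where
  "is_gabor_frame g \<Lambda> \<longleftrightarrow> g \<in> L2 \<and> is_lattice \<Lambda> \<and>
     (\<exists>A>0. \<exists>B>0. \<forall>f\<in>L2.
        (\<lambda>p. (cmod (L2_inner f (tf_shift p g)))\<^sup>2) summable_on \<Lambda> \<and>
        A * (L2_norm f)\<^sup>2 \<le> (\<Sum>\<^sub>\<infinity>p\<in>\<Lambda>. (cmod (L2_inner f (tf_shift p g)))\<^sup>2) \<and>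
        (\<Sum>\<^sub>\<infinity>p\<in>\<Lambda>. (cmod (L2_inner f (tf_shift p g)))\<^sup>2) \<le> B * (L2_norm f)\<^sup>2)"

definition redundancy :: "(real^2) set \<Rightarrow> real" where
  "redundancy \<Lambda> = 1 / vol \<Lambda>"

definition correlations :: "(real \<Rightarrow> complex) \<Rightarrow> (real^2) set \<Rightarrow> real set" where
  "correlations g \<Lambda> =
     {cmod (L2_inner (tf_shift p g) (tf_shift q g)) | p q. p \<in> \<Lambda> \<and> q \<in> \<Lambda> \<and> p \<noteq> q}"

text \<open>The correlation set is infinite, so \<open>Max\<close> is unusable; existence of the maximum is part of
  every assertion made with this predicate.\<close>

definition is_max :: "real set \<Rightarrow> real \<Rightarrow> bool" where
  "is_max S m \<longleftrightarrow> m \<in> S \<and> (\<forall>x\<in>S. x \<le> m)"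

definition max_corr_le ::
  "(real \<Rightarrow> complex) \<Rightarrow> (real^2) set \<Rightarrow> (real \<Rightarrow> complex) \<Rightarrow> (real^2) set \<Rightarrow> bool" where
  "max_corr_le g \<Lambda> h \<Gamma> \<longleftrightarrow>
     (\<exists>m M. is_max (correlations g \<Lambda>) m \<and> is_max (correlations h \<Gamma>) M \<and> m \<le> M)"

definition gaussian_gabor_frames :: "real \<Rightarrow> ((real \<Rightarrow> complex) \<times> (real^2) set) set" where
  "gaussian_gabor_frames \<rho> =
     {(gauss \<sigma>, \<Lambda>) | \<sigma> \<Lambda>. \<sigma> > 0 \<and> is_gabor_frame (gauss \<sigma>) \<Lambda> \<and> redundancy \<Lambda> = \<rho>}"

definition grassmannian_among ::
  "((real \<Rightarrow> complex) \<times> (real^2) set) set \<Rightarrow> (real \<Rightarrow> complex) \<Rightarrow> (real^2) set \<Rightarrow> bool" where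
  "grassmannian_among F g \<Lambda> \<longleftrightarrow> (g, \<Lambda>) \<in> F \<and> (\<forall>(h, \<Gamma>)\<in>F. max_corr_le g \<Lambda> h \<Gamma>)"

definition L_hex :: "real \<Rightarrow> real^2^2" where
  "L_hex \<rho> = vector
     [vector [sqrt 2 / (root 4 3 * sqrt \<rho>), 1 / (root 4 3 * sqrt (2 * \<rho>))],
      vector [0,                             root 4 3 / sqrt (2 * \<rho>)]]"

lemma lattice_of_int_factor:
  assumes "lattice_of L \<subseteq> lattice_of M"
  shows "\<exists>n::int. det L = det M * of_int n"
proof -
  have "\<exists>k :: int^2. column j L = M *v (\<chi> i. real_of_int (k $ i))" for j
  proof -
    have "column j L = L *v (\<chi> i. real_of_int ((axis j 1 :: int^2) $ i))"
    proof -
      have "(\<chi> i. real_of_int ((axis j 1 :: int^2) $ i)) = (axis j 1 :: real^2)"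
        by (simp add: vec_eq_iff axis_def)
      then show ?thesis by (simp only: matrix_vector_mult_basis)
    qed
    then have "column j L \<in> lattice_of L" unfolding lattice_of_def by blast
    then show ?thesis using assms unfolding lattice_of_def by blast
  qed
  then obtain k :: "2 \<Rightarrow> int^2"
    where k: "\<And>j. column j L = M *v (\<chi> i. real_of_int (k j $ i))" by metis
  define U :: "real^2^2" where "U = (\<chi> i j. real_of_int (k j $ i))"
  have "L = M ** U"
  proof -
    have "L $ i $ j = (M ** U) $ i $ j" for i j
      using arg_cong[OF k[of j], of "\<lambda>v. v $ i"]
      by (simp add: column_def matrix_vector_mult_def matrix_matrix_mult_def U_def)
    then show ?thesis by (simp add: vec_eq_iff)
  qed
  then have "det L = det M * det U" by (simp add: det_mul)
  moreover have "det U = of_int (k 1 $ 1 * k 2 $ 2 - k 2 $ 1 * k 1 $ 2)"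
    by (simp add: det_2 U_def)
  ultimately show ?thesis by metis
qed

lemma vol_lattice_of:
  assumes "invertible L"
  shows "vol (lattice_of L) = \<bar>det L\<bar>"
proof -
  have "\<bar>det M\<bar> = \<bar>det L\<bar>" if M: "invertible M" "lattice_of L = lattice_of M" for M
  proof -
    obtain m :: int where m: "det L = det M * of_int m"
      using lattice_of_int_factor[of L M] M(2) by blast
    obtain n :: int where n: "det M = det L * of_int n"
      using lattice_of_int_factor[of M L] M(2) by blast
    have nz: "det L \<noteq> 0" using assms by (simp add: invertible_det_nz)
    have "det L * 1 = det M * of_int m" using m by simp
    also have "\<dots> = det L * of_int (n * m)" by (subst n) simp
    finally have "(of_int (n * m) :: real) = 1" using nz by simp
    then have "n * m = 1" by (simp only: of_int_eq_1_iff)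
    then have "n = 1 \<or> n = -1" by (auto simp only: zmult_eq_1_iff)
    then have "\<bar>of_int n :: real\<bar> = 1" by auto
    then show ?thesis by (subst n) (simp add: abs_mult)
  qed
  then show ?thesis unfolding vol_def using assms by (intro the_equality) blast+
qed

end

theory Submission imports Defs "HOL-Probability.Characteristic_Functions" begin

text \<open>The modulus of the correlation of two shifts of \<open>\<phi>\<^sub>\<sigma>\<close> is \<open>exp (- \<pi> / 2 * Q (\<lambda> - \<lambda>'))\<close> with the
  area-preserving quadratic form \<open>Q (x, \<omega>) = x\<^sup>2 / \<sigma> + \<sigma> * \<omega>\<^sup>2\<close>, so the maximal correlation is decided by
  the minimum of \<open>Q\<close> on the nonzero lattice points. By Hermite's bound for positive definite binary
  forms this minimum is at most \<open>2 / \<surd>3\<close> times the volume, and the hexagonal lattice with \<open>\<sigma> = 1\<close>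
  attains the bound.\<close>

section \<open>Correlations of time-frequency shifted Gaussians\<close>

text \<open>The integral is the characteristic function of the standard normal distribution,
  unfolded to its density.\<close>

lemma std_normal_fourier:
  "(\<integral>x. std_normal_density x *\<^sub>R iexp (w * x) \<partial>lborel) = complex_of_real (exp (- w\<^sup>2 / 2))"
proof -
  have "char std_normal_distribution w = (\<integral>x. std_normal_density x *\<^sub>R iexp (w * x) \<partial>lborel)"
    unfolding char_def by (subst integral_density) auto
  then show ?thesis by (simp add: char_std_normal_distribution)
qed

text \<open>The product of two translated Gaussians is a Gaussian around their midpoint, damped by a
  factor in the distance of the centres. The modulations contribute a character, so an affine
  substitution leaves the Fourier integral of the normal density.\<close>

lemma cmod_L2_inner_tf_shift_gauss:
  assumes "\<sigma> > 0"
  shows "cmod (L2_inner (tf_shift p (gauss \<sigma>)) (tf_shift q (gauss \<sigma>))) =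
    exp (- (pi / 2) * ((p $ 1 - q $ 1)\<^sup>2 / \<sigma> + \<sigma> * (p $ 2 - q $ 2)\<^sup>2))"
proof -
  \<comment> \<open>\<open>c\<close> is the standard deviation of the density proportional to
    \<open>exp (- 2 * pi * t\<^sup>2 / \<sigma>)\<close>, the shape of the product of the two
    windows.\<close>
  define c where "c = sqrt (\<sigma> / (4 * pi))"
  define m where "m = (p $ 1 + q $ 1) / 2"
  define d where "d = p $ 1 - q $ 1"
  define w where "w = p $ 2 - q $ 2"
  define K where "K = sqrt (2 / \<sigma>) * sqrt (2 * pi) * exp (- pi * d\<^sup>2 / (2 * \<sigma>))"
  let ?f = "\<lambda>t. tf_shift p (gauss \<sigma>) t * cnj (tf_shift q (gauss \<sigma>) t)"
  have c: "c > 0" "c\<^sup>2 = \<sigma> / (4 * pi)" using assms by (simp_all add: c_def)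
  have quarter: "(2 / \<sigma>) powr (1/4) * (2 / \<sigma>) powr (1/4) = sqrt (2 / \<sigma>)"
    using assms by (simp add: powr_half_sqrt flip: powr_add)
  have f: "?f (m + c * y) =
      (complex_of_real K * cis (2 * pi * w * m)) * (std_normal_density y *\<^sub>R iexp ((2 * pi * w * c) * y))" for y
  proof -
    let ?t = "m + c * y"
    have "?f ?t = (cis (2 * pi * p $ 2 * ?t) * cnj (cis (2 * pi * q $ 2 * ?t))) *
        complex_of_real (((2 / \<sigma>) powr (1/4) * (2 / \<sigma>) powr (1/4)) *
          (exp (- pi * (?t - p $ 1)\<^sup>2 / \<sigma>) * exp (- pi * (?t - q $ 1)\<^sup>2 / \<sigma>)))"
      by (simp add: tf_shift_def gauss_def)
    also have "cis (2 * pi * p $ 2 * ?t) * cnj (cis (2 * pi * q $ 2 * ?t)) =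
        cis (2 * pi * w * m) * cis ((2 * pi * w * c) * y)"
      by (simp add: cis_cnj cis_mult w_def algebra_simps)
    also have "exp (- pi * (?t - p $ 1)\<^sup>2 / \<sigma>) * exp (- pi * (?t - q $ 1)\<^sup>2 / \<sigma>) =
        exp (- pi * d\<^sup>2 / (2 * \<sigma>)) * exp (- y\<^sup>2 / 2)"
    proof -
      \<comment> \<open>The cross terms cancel because \<open>m\<close> is the midpoint of the two
        centres.\<close>
      have "(?t - p $ 1)\<^sup>2 + (?t - q $ 1)\<^sup>2 = 2 * c\<^sup>2 * y\<^sup>2 + d\<^sup>2 / 2"
        by (simp add: m_def d_def power2_eq_square field_simps)
      then have e: "(?t - p $ 1)\<^sup>2 + (?t - q $ 1)\<^sup>2 = 2 * (\<sigma> / (4 * pi)) * y\<^sup>2 + d\<^sup>2 / 2"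
        unfolding c(2) .
      have "- pi * (?t - p $ 1)\<^sup>2 / \<sigma> + - pi * (?t - q $ 1)\<^sup>2 / \<sigma> =
          - pi / \<sigma> * ((?t - p $ 1)\<^sup>2 + (?t - q $ 1)\<^sup>2)"
        by (simp add: algebra_simps add_divide_distrib)
      also have "\<dots> = - pi * d\<^sup>2 / (2 * \<sigma>) + - y\<^sup>2 / 2"
        unfolding e using assms by (simp add: field_simps)
      finally show ?thesis unfolding exp_add[symmetric] by (rule arg_cong)
    qed
    finally show ?thesis
      unfolding quarter
      by (simp add: K_def std_normal_density_def cis_conv_exp scaleR_conv_of_real ac_simps)
  qed
  have "L2_inner (tf_shift p (gauss \<sigma>)) (tf_shift q (gauss \<sigma>)) = c *\<^sub>R (\<integral>y. ?f (m + c * y) \<partial>lborel)"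
    unfolding L2_inner_def using lborel_integral_real_affine[of c ?f m] c by simp
  also have "\<dots> = c *\<^sub>R ((complex_of_real K * cis (2 * pi * w * m)) *
      complex_of_real (exp (- (2 * pi * w * c)\<^sup>2 / 2)))"
    unfolding f integral_mult_right_zero std_normal_fourier ..
  finally have "cmod (L2_inner (tf_shift p (gauss \<sigma>)) (tf_shift q (gauss \<sigma>))) =
      c * K * exp (- (2 * pi * w * c)\<^sup>2 / 2)"
    using c assms by (simp add: norm_mult K_def)
  \<comment> \<open>The normalising factors multiply to 1, which reflects the unit norm of the
    window.\<close>
  also have "c * K = exp (- pi * d\<^sup>2 / (2 * \<sigma>))"
    using assms by (simp add: c_def K_def flip: real_sqrt_mult)
  also have "exp (- pi * d\<^sup>2 / (2 * \<sigma>)) * exp (- (2 * pi * w * c)\<^sup>2 / 2) =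
      exp (- (pi / 2) * (d\<^sup>2 / \<sigma> + \<sigma> * w\<^sup>2))"
    unfolding exp_add[symmetric] power_mult_distrib c(2)
    using assms by (simp add: field_simps power2_eq_square)
  finally show ?thesis unfolding d_def w_def .
qed

section \<open>Correlations as values on the nonzero lattice points\<close>

lemma lattice_of_diff:
  assumes "p \<in> lattice_of L" "q \<in> lattice_of L"
  shows "p - q \<in> lattice_of L"
proof -
  obtain k l :: "int^2" where "p = L *v (\<chi> i. real_of_int (k $ i))" "q = L *v (\<chi> i. real_of_int (l $ i))"
    using assms unfolding lattice_of_def by blast
  then have "p - q = L *v (\<chi> i. real_of_int ((k - l) $ i))"
    by (simp add: vec_eq_iff matrix_vector_mult_def sum_2 algebra_simps)
  then show ?thesis unfolding lattice_of_def by blast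
qed

lemma zero_in_lattice_of: "0 \<in> lattice_of L"
proof -
  have "0 = L *v (\<chi> i. real_of_int ((0 :: int^2) $ i))"
    by (simp add: vec_eq_iff matrix_vector_mult_def)
  then show ?thesis unfolding lattice_of_def by blast
qed

text \<open>For \<open>\<sigma> > 0\<close> this is the squared Euclidean length after the
  area-preserving dilation of the two axes by \<open>1 / sqrt \<sigma>\<close> and
  \<open>sqrt \<sigma>\<close>.\<close>

definition gauss_form :: "real \<Rightarrow> real^2 \<Rightarrow> real" where
  "gauss_form \<sigma> p = (p $ 1)\<^sup>2 / \<sigma> + \<sigma> * (p $ 2)\<^sup>2"

text \<open>A correlation depends only on the difference of the two points, and since a lattice is a
  group, the differences of distinct points are exactly its nonzero points.\<close>

lemma correlations_gauss:
  assumes "\<sigma> > 0"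
  shows "correlations (gauss \<sigma>) (lattice_of L) =
    (\<lambda>p. exp (- (pi / 2) * gauss_form \<sigma> p)) ` (lattice_of L - {0})"
proof -
  have c: "cmod (L2_inner (tf_shift p (gauss \<sigma>)) (tf_shift q (gauss \<sigma>))) =
      exp (- (pi / 2) * gauss_form \<sigma> (p - q))" for p q
    by (simp only: cmod_L2_inner_tf_shift_gauss[OF assms] gauss_form_def vector_minus_component)
  have "p \<in> lattice_of L - {0} \<Longrightarrow> \<exists>p' q'. p = p' - q' \<and> p' \<in> lattice_of L \<and> q' \<in> lattice_of L \<and> p' \<noteq> q'" for p
    using zero_in_lattice_of[of L] by (intro exI[of _ p] exI[of _ 0]) auto
  then show ?thesis
    unfolding correlations_def c using lattice_of_diff[of _ L] by (auto simp: image_iff) metis+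
qed

section \<open>Binary quadratic forms: attained minimum and Hermite's bound\<close>

definition binary_form :: "real \<Rightarrow> real \<Rightarrow> real \<Rightarrow> int \<Rightarrow> int \<Rightarrow> real" where
  "binary_form A B C a b = A * (real_of_int a)\<^sup>2 + B * real_of_int a * real_of_int b + C * (real_of_int b)\<^sup>2"

lemma binary_form_swap: "binary_form A B C a b = binary_form C B A b a"
  by (simp add: binary_form_def)

text \<open>Completing the square writes \<open>4 * A\<close> times the form as
  \<open>4 * A * C - B\<^sup>2\<close> times \<open>b\<^sup>2\<close> plus a square. The ceiling
  makes the bound an integer, as the finiteness argument requires.\<close>

lemma binary_form_snd_bound:
  assumes "A > 0" "4 * A * C - B\<^sup>2 > 0" "binary_form A B C a b \<le> c"
  shows "b\<^sup>2 \<le> \<lceil>4 * A * c / (4 * A * C - B\<^sup>2)\<rceil>"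
proof -
  have "(4 * A * C - B\<^sup>2) * (real_of_int b)\<^sup>2 \<le>
      (4 * A * C - B\<^sup>2) * (real_of_int b)\<^sup>2 + (2 * A * real_of_int a + B * real_of_int b)\<^sup>2" by simp
  also have "\<dots> = 4 * A * binary_form A B C a b"
    by (simp add: binary_form_def power2_eq_square algebra_simps)
  also have "\<dots> \<le> 4 * A * c" using assms by simp
  finally have "(real_of_int b)\<^sup>2 \<le> 4 * A * c / (4 * A * C - B\<^sup>2)"
    using assms(2) by (simp add: pos_le_divide_eq mult.commute)
  then show ?thesis by (metis le_of_int_ceiling of_int_le_iff of_int_power order_trans)
qed

lemma finite_int_square_le: "finite {b::int. b\<^sup>2 \<le> n}"
proof (rule finite_subset)
  show "{b::int. b\<^sup>2 \<le> n} \<subseteq> {- n..n}"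
  proof
    fix b :: int assume "b \<in> {b. b\<^sup>2 \<le> n}"
    moreover have "\<bar>b\<bar> \<le> b\<^sup>2"
      using self_le_power[of "\<bar>b\<bar>" 2] by (cases "b = 0") auto
    ultimately show "b \<in> {- n..n}" by auto
  qed
qed simp

lemma finite_binary_form_le:
  assumes "A > 0" "4 * A * C - B\<^sup>2 > 0"
  shows "finite {(a, b). binary_form A B C a b \<le> c}"
proof -
  \<comment> \<open>Positive definiteness is symmetric in \<open>A\<close> and \<open>C\<close>, so
    the bound on \<open>b\<close> also bounds \<open>a\<close> after swapping the variables.\<close>
  have "4 * (A * C) > 0" using assms(2) zero_le_power2[of B] by linarith
  then have C: "C > 0" using assms(1) by (simp add: zero_less_mult_iff)
  have D: "4 * C * A - B\<^sup>2 > 0" using assms(2) by (simp add: ac_simps)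
  show ?thesis
  proof (rule finite_subset)
    show "{(a, b). binary_form A B C a b \<le> c} \<subseteq>
      {a. a\<^sup>2 \<le> \<lceil>4 * C * c / (4 * C * A - B\<^sup>2)\<rceil>} \<times> {b. b\<^sup>2 \<le> \<lceil>4 * A * c / (4 * A * C - B\<^sup>2)\<rceil>}"
      using binary_form_snd_bound[OF assms] binary_form_snd_bound[OF C D] binary_form_swap
      by fastforce
  qed (intro finite_cartesian_product finite_int_square_le)
qed

text \<open>Only finitely many points have a value at most that of \<open>(1, 0)\<close>; a minimum
  over the nonzero ones among them is global, as all other values are larger.\<close>

lemma binary_form_minimum:
  assumes "A > 0" "4 * A * C - B\<^sup>2 > 0"
  obtains a b where "(a, b) \<noteq> (0, 0)"
    "\<And>x y. (x, y) \<noteq> (0, 0) \<Longrightarrow> binary_form A B C a b \<le> binary_form A B C x y"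
proof -
  let ?S = "{(a, b). binary_form A B C a b \<le> binary_form A B C 1 0} - {(0, 0)}"
  let ?f = "\<lambda>(a, b). binary_form A B C a b"
  have S: "finite ?S" "(1, 0) \<in> ?S" using finite_binary_form_le[OF assms] by auto
  obtain w where w: "is_arg_min ?f (\<lambda>z. z \<in> ?S) w"
    using ex_is_arg_min_if_finite[OF S(1)] S(2) by blast
  obtain a b where "w = (a, b)" by (cases w)
  with w have ab: "(a, b) \<in> ?S" "\<And>z. z \<in> ?S \<Longrightarrow> ?f (a, b) \<le> ?f z"
    unfolding is_arg_min_linorder by blast+
  show thesis
  proof (rule that[of a b])
    show "(a, b) \<noteq> (0, 0)" using ab(1) by simp
    fix x y :: int assume "(x, y) \<noteq> (0, 0)"
    then show "binary_form A B C a b \<le> binary_form A B C x y"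
      using ab(1) ab(2)[of "(x, y)"] by (cases "(x, y) \<in> ?S") auto
  qed
qed

lemma binary_form_pos:
  assumes "A > 0" "4 * A * C - B\<^sup>2 > 0" "(a, b) \<noteq> (0, 0)"
  shows "binary_form A B C a b > 0"
proof -
  have e: "4 * A * binary_form A B C a b =
      (4 * A * C - B\<^sup>2) * (real_of_int b)\<^sup>2 + (2 * A * real_of_int a + B * real_of_int b)\<^sup>2"
    by (simp add: binary_form_def power2_eq_square algebra_simps)
  have "\<dots> > 0"
  proof (cases "b = 0")
    case True then show ?thesis using assms by simp
  next
    case False then show ?thesis using assms by (simp add: add_pos_nonneg)
  qed
  then show ?thesis using assms(1) unfolding e[symmetric] by (simp add: zero_less_mult_iff)
qed

text \<open>A minimal vector is primitive and extends to a basis of the integer lattice. In a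
  reduced basis the mixed coefficient is at most the minimum \<open>m\<close> in absolute value, so
  the discriminant expression is at least \<open>4 * m\<^sup>2 - m\<^sup>2\<close>.\<close>

lemma hermite_bound:
  assumes "A > 0" "4 * A * C - B\<^sup>2 > 0" "(a, b) \<noteq> (0, 0)"
    and min: "\<And>x y. (x, y) \<noteq> (0, 0) \<Longrightarrow> binary_form A B C a b \<le> binary_form A B C x y"
  shows "3 * (binary_form A B C a b)\<^sup>2 \<le> 4 * A * C - B\<^sup>2"
proof -
  let ?m = "binary_form A B C a b"
  have m: "?m > 0" using binary_form_pos assms by blast
  \<comment> \<open>Dividing a minimal vector by \<open>gcd a b\<close> divides its value by the
    square of the gcd, which minimality allows only for gcd 1.\<close>
  have "gcd a b = 1"
  proof -
    let ?g = "gcd a b"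
    obtain x y where xy: "a = ?g * x" "b = ?g * y" by (meson dvdE gcd_dvd1 gcd_dvd2)
    have g: "?g > 0" using assms(3) by (simp add: gcd_pos_int)
    have "(x, y) \<noteq> (0, 0)" using xy assms(3) by auto
    then have le: "?m \<le> binary_form A B C x y" by (rule min)
    have "?m = (real_of_int ?g)\<^sup>2 * binary_form A B C x y"
      by (subst xy(1), subst xy(2)) (simp add: binary_form_def power2_eq_square algebra_simps)
    then have "(real_of_int ?g)\<^sup>2 * ?m \<le> 1 * ?m"
      using mult_left_mono[OF le zero_le_power2] by (metis mult_1)
    then have "(real_of_int ?g)\<^sup>2 \<le> 1" using m by (simp only: mult_le_cancel_right_pos)
    then have "\<bar>real_of_int ?g\<bar> \<le> 1" by (simp add: abs_square_le_1)
    then show ?thesis using g by linarith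
  qed
  then obtain u v where uv: "u * a + v * b = 1" using bezout_int[of a b] by auto
  \<comment> \<open>\<open>(a, b)\<close>, \<open>(- v, u)\<close> is a basis of \<open>\<int>\<^sup>2\<close> and \<open>P\<close> the mixed coefficient of the form in it.
    Adding \<open>n\<close> times the first basis vector to the second turns \<open>P\<close> into \<open>R\<close> with \<open>\<bar>R\<bar> \<le> ?m\<close>.\<close>
  define P where "P = 2 * A * a * (- v) + B * (a * u - b * v) + 2 * C * b * u"
  define n where "n = round (- P / (2 * ?m))"
  define c d where "c = - v + n * a" and "d = u + n * b"
  define R where "R = P + 2 * n * ?m"
  have det: "a * d - b * c = 1" using uv by (simp add: c_def d_def algebra_simps)
  then have "(c, d) \<noteq> (0, 0)" by auto
  then have le: "?m \<le> binary_form A B C c d" by (rule min)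
  have "\<bar>of_int n - (- P / (2 * ?m))\<bar> \<le> 1 / 2" unfolding n_def by (rule of_int_round_abs_le)
  then have "\<bar>of_int n - (- P / (2 * ?m))\<bar> * (2 * ?m) \<le> 1 / 2 * (2 * ?m)"
    using m by (intro mult_right_mono) auto
  also have "\<bar>of_int n - (- P / (2 * ?m))\<bar> * (2 * ?m) = \<bar>(of_int n - (- P / (2 * ?m))) * (2 * ?m)\<bar>"
    using m by (simp add: abs_mult)
  also have "(of_int n - (- P / (2 * ?m))) * (2 * ?m) = R"
    using m by (simp add: R_def field_simps)
  finally have "R\<^sup>2 \<le> ?m\<^sup>2" using m by (simp add: abs_le_square_iff[symmetric])
  \<comment> \<open>A change of basis multiplies the discriminant expression by the square of its
    determinant, here 1.\<close>
  moreover have "4 * ?m * binary_form A B C c d - R\<^sup>2 = (4 * A * C - B\<^sup>2) * (real_of_int (a * d - b * c))\<^sup>2"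
  proof -
    have "R = 2 * A * a * c + B * (a * d + b * c) + 2 * C * b * d"
      by (simp add: R_def P_def c_def d_def binary_form_def power2_eq_square algebra_simps)
    then show ?thesis
      by (simp add: binary_form_def power2_eq_square algebra_simps)
  qed
  moreover have "?m * ?m \<le> ?m * binary_form A B C c d" using le m by (intro mult_left_mono) auto
  ultimately show ?thesis unfolding det by (simp add: power2_eq_square)
qed

section \<open>Shortest vectors of a lattice\<close>

text \<open>The coefficients come from the Gram matrix of the columns of \<open>L\<close>: the outer
  ones are the values at the columns, the middle one is twice their inner product.\<close>

lemma gauss_form_lattice_point:
  fixes L :: "real^2^2" and k :: "int^2"
  assumes "\<sigma> > 0"
  shows "gauss_form \<sigma> (L *v (\<chi> i. real_of_int (k $ i))) =
    binary_form ((L $ 1 $ 1)\<^sup>2 / \<sigma> + \<sigma> * (L $ 2 $ 1)\<^sup>2)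
      (2 * (L $ 1 $ 1 * L $ 1 $ 2 / \<sigma> + \<sigma> * L $ 2 $ 1 * L $ 2 $ 2))
      ((L $ 1 $ 2)\<^sup>2 / \<sigma> + \<sigma> * (L $ 2 $ 2)\<^sup>2) (k $ 1) (k $ 2)"
  using assms
  by (simp add: gauss_form_def binary_form_def matrix_vector_mult_def sum_2 power2_eq_square field_simps)

lemma gauss_form_minimum:
  assumes "\<sigma> > 0" "invertible L"
  obtains p where "p \<in> lattice_of L" "p \<noteq> 0"
    "\<And>q. q \<in> lattice_of L \<Longrightarrow> q \<noteq> 0 \<Longrightarrow> gauss_form \<sigma> p \<le> gauss_form \<sigma> q"
    "gauss_form \<sigma> p \<le> 2 / sqrt 3 * \<bar>det L\<bar>"
proof -
  define A where "A = (L $ 1 $ 1)\<^sup>2 / \<sigma> + \<sigma> * (L $ 2 $ 1)\<^sup>2"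
  define B where "B = 2 * (L $ 1 $ 1 * L $ 1 $ 2 / \<sigma> + \<sigma> * L $ 2 $ 1 * L $ 2 $ 2)"
  define C where "C = (L $ 1 $ 2)\<^sup>2 / \<sigma> + \<sigma> * (L $ 2 $ 2)\<^sup>2"
  have gf: "gauss_form \<sigma> (L *v (\<chi> i. real_of_int (k $ i))) = binary_form A B C (k $ 1) (k $ 2)" for k
    unfolding A_def B_def C_def by (rule gauss_form_lattice_point) fact
  have nz: "det L \<noteq> 0" using assms(2) by (simp add: invertible_det_nz)
  \<comment> \<open>Four times the Gram determinant; \<open>\<sigma>\<close> cancels because the
    form has determinant 1.\<close>
  have D: "4 * A * C - B\<^sup>2 = 4 * (det L)\<^sup>2"
    using assms(1) by (simp add: A_def B_def C_def det_2 power2_eq_square field_simps)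
  have D0: "4 * A * C - B\<^sup>2 > 0" using nz by (simp add: D)
  have "L $ 1 $ 1 \<noteq> 0 \<or> L $ 2 $ 1 \<noteq> 0" using nz by (auto simp: det_2)
  then have A: "A > 0" using assms(1) by (auto simp: A_def add_pos_nonneg add_nonneg_pos)
  obtain a b where ab: "(a, b) \<noteq> (0, 0)"
      "\<And>x y. (x, y) \<noteq> (0, 0) \<Longrightarrow> binary_form A B C a b \<le> binary_form A B C x y"
    using binary_form_minimum[OF A D0] by metis
  define k :: "int^2" where "k = vector [a, b]"
  have k: "k $ 1 = a" "k $ 2 = b" by (simp_all add: k_def)
  let ?p = "L *v (\<chi> i. real_of_int (k $ i))"
  have pos: "gauss_form \<sigma> ?p > 0" unfolding gf k using binary_form_pos[OF A D0 ab(1)] .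
  show thesis
  proof (rule that[of ?p])
    show "?p \<in> lattice_of L" unfolding lattice_of_def by blast
    show "?p \<noteq> 0" using pos by (auto simp: gauss_form_def)
    show "gauss_form \<sigma> ?p \<le> gauss_form \<sigma> q" if q: "q \<in> lattice_of L" "q \<noteq> 0" for q
    proof -
      obtain l :: "int^2" where l: "q = L *v (\<chi> i. real_of_int (l $ i))"
        using q(1) unfolding lattice_of_def by blast
      have "(l $ 1, l $ 2) \<noteq> (0, 0)"
        using q(2) l by (auto simp: matrix_vector_mult_def sum_2 vec_eq_iff)
      then show ?thesis unfolding l gf k by (rule ab(2))
    qed
    have "3 * (gauss_form \<sigma> ?p)\<^sup>2 \<le> 4 * (det L)\<^sup>2"
      using hermite_bound[OF A D0 ab] unfolding gf k D .
    then have "(gauss_form \<sigma> ?p)\<^sup>2 \<le> (2 / sqrt 3 * \<bar>det L\<bar>)\<^sup>2"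
      by (simp add: power_mult_distrib power_divide)
    then show "gauss_form \<sigma> ?p \<le> 2 / sqrt 3 * \<bar>det L\<bar>" by (rule power2_le_imp_le) simp
  qed
qed

text \<open>The exponential reverses the order, so a shortest nonzero vector realises the largest
  correlation.\<close>

lemma is_max_correlations_gauss:
  assumes "\<sigma> > 0" "p \<in> lattice_of L" "p \<noteq> 0"
    "\<And>q. q \<in> lattice_of L \<Longrightarrow> q \<noteq> 0 \<Longrightarrow> gauss_form \<sigma> p \<le> gauss_form \<sigma> q"
  shows "is_max (correlations (gauss \<sigma>) (lattice_of L)) (exp (- (pi / 2) * gauss_form \<sigma> p))"
  using assms by (auto simp: is_max_def correlations_gauss)

section \<open>The hexagonal lattice and the comparison\<close>

lemma root_4_3_squared: "root 4 3 * root 4 3 = sqrt 3"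
  using real_root_mult_exp[of 2 2 3] real_sqrt_mult_self[of "sqrt 3"]
  by (simp add: sqrt_def)

lemma det_L_hex:
  assumes "\<rho> > 0"
  shows "det (L_hex \<rho>) = 1 / \<rho>"
  using assms by (simp add: det_2 L_hex_def real_sqrt_mult field_simps)

text \<open>The form on this lattice is a multiple of \<open>a\<^sup>2 + a * b + b\<^sup>2\<close>,
  which takes positive integer values away from the origin.\<close>

lemma gauss_form_hex_ge:
  assumes "\<rho> > 0" "p \<in> lattice_of (L_hex \<rho>)" "p \<noteq> 0"
  shows "2 / sqrt 3 * (1 / \<rho>) \<le> gauss_form 1 p"
proof -
  obtain k :: "int^2" where k: "p = L_hex \<rho> *v (\<chi> i. real_of_int (k $ i))"
    using assms(2) unfolding lattice_of_def by blast
  define a b where "a = k $ 1" and "b = k $ 2"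
  have r: "(root 4 3)\<^sup>2 = sqrt 3" by (simp add: power2_eq_square root_4_3_squared)
  have s: "sqrt 3 * sqrt 3 = (3::real)" by simp
  have "gauss_form 1 p = binary_form (2 / (sqrt 3 * \<rho>)) (2 / (sqrt 3 * \<rho>)) (2 / (sqrt 3 * \<rho>)) a b"
  proof -
    \<comment> \<open>The three coefficients agree because the generators have equal length and
      enclose an angle of 60 degrees.\<close>
    have 1: "(L_hex \<rho> $ 1 $ 1)\<^sup>2 / 1 + 1 * (L_hex \<rho> $ 2 $ 1)\<^sup>2 = 2 / (sqrt 3 * \<rho>)"
      using assms(1) by (simp add: L_hex_def power_divide power_mult_distrib r)
    have 2: "2 * (L_hex \<rho> $ 1 $ 1 * L_hex \<rho> $ 1 $ 2 / 1 + 1 * L_hex \<rho> $ 2 $ 1 * L_hex \<rho> $ 2 $ 2) = 2 / (sqrt 3 * \<rho>)"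
      using assms(1) by (simp add: L_hex_def real_sqrt_mult root_4_3_squared[symmetric])
    have 3: "(L_hex \<rho> $ 1 $ 2)\<^sup>2 / 1 + 1 * (L_hex \<rho> $ 2 $ 2)\<^sup>2 = 2 / (sqrt 3 * \<rho>)"
      using assms(1) s by (simp add: L_hex_def power_divide power_mult_distrib r field_simps)
    show ?thesis unfolding k gauss_form_lattice_point[OF zero_less_one] 1 2 3 a_def b_def ..
  qed
  also have "\<dots> = 2 / sqrt 3 * (1 / \<rho>) * real_of_int (a\<^sup>2 + a * b + b\<^sup>2)"
    by (simp add: binary_form_def algebra_simps add_divide_distrib)
  finally have e: "gauss_form 1 p = 2 / sqrt 3 * (1 / \<rho>) * real_of_int (a\<^sup>2 + a * b + b\<^sup>2)" .
  have "a \<noteq> 0 \<or> b \<noteq> 0"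
    using assms(3) unfolding k a_def b_def by (auto simp: matrix_vector_mult_def sum_2 vec_eq_iff)
  then have "(2 * a + b)\<^sup>2 + 3 * b\<^sup>2 > 0"
    by (cases "b = 0") (auto simp: add_nonneg_pos)
  moreover have "(2 * a + b)\<^sup>2 + 3 * b\<^sup>2 = 4 * (a\<^sup>2 + a * b + b\<^sup>2)"
    by (simp add: power2_eq_square algebra_simps)
  ultimately have "0 < a\<^sup>2 + a * b + b\<^sup>2" by (metis zero_less_mult_pos zero_less_numeral)
  then have "1 \<le> a\<^sup>2 + a * b + b\<^sup>2" by simp
  then have "1 \<le> real_of_int (a\<^sup>2 + a * b + b\<^sup>2)" by (simp only: of_int_1_le_iff)
  then have "2 / sqrt 3 * (1 / \<rho>) * 1 \<le> 2 / sqrt 3 * (1 / \<rho>) * real_of_int (a\<^sup>2 + a * b + b\<^sup>2)"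
    using assms(1) by (intro mult_left_mono) auto
  then show ?thesis unfolding e by simp
qed

lemma max_corr_le_hex:
  assumes "\<rho> > 0" "\<sigma> > 0" "is_lattice \<Lambda>" "vol \<Lambda> = 1 / \<rho>"
  shows "max_corr_le (gauss 1) (lattice_of (L_hex \<rho>)) (gauss \<sigma>) \<Lambda>"
proof -
  obtain L where L: "invertible L" "\<Lambda> = lattice_of L" using assms(3) is_lattice_def by blast
  have detL: "\<bar>det L\<bar> = 1 / \<rho>" using assms(4) vol_lattice_of[OF L(1)] L(2) by simp
  have inv: "invertible (L_hex \<rho>)" using assms(1) by (simp add: invertible_det_nz det_L_hex)
  obtain p where p: "p \<in> lattice_of (L_hex \<rho>)" "p \<noteq> 0"
    "\<And>q. q \<in> lattice_of (L_hex \<rho>) \<Longrightarrow> q \<noteq> 0 \<Longrightarrow> gauss_form 1 p \<le> gauss_form 1 q"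
    using gauss_form_minimum[OF zero_less_one inv] by metis
  obtain p' where p': "p' \<in> lattice_of L" "p' \<noteq> 0"
    "\<And>q. q \<in> lattice_of L \<Longrightarrow> q \<noteq> 0 \<Longrightarrow> gauss_form \<sigma> p' \<le> gauss_form \<sigma> q"
    "gauss_form \<sigma> p' \<le> 2 / sqrt 3 * \<bar>det L\<bar>"
    using gauss_form_minimum[OF assms(2) L(1)] by metis
  \<comment> \<open>At equal volume, Hermite's upper bound for an arbitrary lattice is the lower
    bound for the hexagonal one.\<close>
  have "gauss_form \<sigma> p' \<le> gauss_form 1 p"
    using p'(4) gauss_form_hex_ge[OF assms(1) p(1,2)] unfolding detL by linarith
  then have "exp (- (pi / 2) * gauss_form 1 p) \<le> exp (- (pi / 2) * gauss_form \<sigma> p')" by simp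
  then show ?thesis
    unfolding max_corr_le_def L(2)
    using is_max_correlations_gauss[OF zero_less_one p] is_max_correlations_gauss[OF assms(2) p'(1-3)]
    by blast
qed

theorem mainTheorem6:
  fixes \<rho> :: real
  assumes "\<rho> > 1"
  shows "is_lattice (lattice_of (L_hex \<rho>)) \<and> redundancy (lattice_of (L_hex \<rho>)) = \<rho> \<and>
    (\<forall>\<sigma> \<Lambda>. \<sigma> > 0 \<and> is_lattice \<Lambda> \<and> vol \<Lambda> = 1 / \<rho> \<longrightarrow>
       max_corr_le (gauss 1) (lattice_of (L_hex \<rho>)) (gauss \<sigma>) \<Lambda>) \<and>
    ((\<forall>\<sigma> \<Lambda>. \<sigma> > 0 \<and> is_lattice \<Lambda> \<and> vol \<Lambda> < 1 \<longrightarrow> is_gabor_frame (gauss \<sigma>) \<Lambda>) \<longrightarrow>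
       grassmannian_among (gaussian_gabor_frames \<rho>) (gauss 1) (lattice_of (L_hex \<rho>)))"
proof -
  let ?H = "lattice_of (L_hex \<rho>)"
  have \<rho>: "\<rho> > 0" using assms by simp
  have inv: "invertible (L_hex \<rho>)" using \<rho> by (simp add: invertible_det_nz det_L_hex)
  have lat: "is_lattice ?H" unfolding is_lattice_def using inv by blast
  have vol: "vol ?H = 1 / \<rho>" using vol_lattice_of[OF inv] det_L_hex[OF \<rho>] \<rho> by simp
  have red: "redundancy ?H = \<rho>" by (simp add: redundancy_def vol)
  have "grassmannian_among (gaussian_gabor_frames \<rho>) (gauss 1) ?H"
    if frames: "\<forall>\<sigma> \<Lambda>. \<sigma> > 0 \<and> is_lattice \<Lambda> \<and> vol \<Lambda> < 1 \<longrightarrow> is_gabor_frame (gauss \<sigma>) \<Lambda>"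
  proof -
    \<comment> \<open>The assumed frame criterion applies since \<open>\<rho> > 1\<close> makes the
      volume \<open>1 / \<rho>\<close> less than 1.\<close>
    have "is_gabor_frame (gauss 1) ?H" using frames lat vol assms by simp
    then have "(gauss 1, ?H) \<in> gaussian_gabor_frames \<rho>"
      unfolding gaussian_gabor_frames_def using red zero_less_one by blast
    moreover have "max_corr_le (gauss 1) ?H (gauss \<sigma>) \<Lambda>"
      if "\<sigma> > 0" "is_gabor_frame (gauss \<sigma>) \<Lambda>" "redundancy \<Lambda> = \<rho>" for \<sigma> \<Lambda>
    proof (rule max_corr_le_hex[OF \<rho> that(1)])
      show "is_lattice \<Lambda>" using that(2) is_gabor_frame_def by blast
      show "vol \<Lambda> = 1 / \<rho>" using that(3) by (auto simp: redundancy_def)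
    qed
    ultimately show ?thesis
      unfolding grassmannian_among_def by (auto simp: gaussian_gabor_frames_def)
  qed
  then show ?thesis using lat red max_corr_le_hex[OF \<rho>] by blast
qed

end
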